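(* Let $|\mathrm{W}\rangle=\frac{1}{\sqrt3}(|100\rangle+|010\rangle+|001\rangle)\in(\mathbb{C}^2)^{\otimes 3}$. For every normalized pure three-qubit state $|\psi\rangle\in(\mathbb{C}^2)^{\otimes3}$ one has $G(|\psi\rangle)^2\ge G(|\mathrm{W}\rangle)^2=\frac49$, equivalently $E_G(|\psi\rangle)\le E_G(|\mathrm{W}\rangle)=\frac59$. Moreover equality holds if and only if $|\psi\rangle=e^{i\phi}(U_1\otimes U_2\otimes U_3)|\mathrm{W}\rangle$ for some single-qubit unitaries $U_1,U_2,U_3$ and some phase $\phi\in\mathbb{R}$; i.e. up to local unitary transformations the W state is the unique maximally entangled pure three-qubit state with respect to the geometric measure.
   Context: For a normalized pure state $|\psi\rangle$ of an $n$-partite system, $G(|\psi\rangle):=\max |\langle a_1|\langle a_2|\cdots\langle a_n|\,\psi\rangle|$, the maximum taken over all normalized single-party states $|a_1\rangle,\dots,|a_n\rangle$ of the respective subsystems. The geometric measure of entanglement is $E_G(|\psi\rangle):=1-G(|\psi\rangle)^2$. *)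

theory Defs
  imports "HOL-Analysis.Analysis"
begin

text \<open>Computational basis of a qubit is indexed by bool: False = |0>, True = |1>.
  A single-qubit vector is a function bool => complex; a three-qubit vector is
  a function bool => bool => bool => complex (amplitude of |ijk>).\<close>

type_synonym qubit = "bool \<Rightarrow> complex"
type_synonym state3 = "bool \<Rightarrow> bool \<Rightarrow> bool \<Rightarrow> complex"
type_synonym qmat = "bool \<Rightarrow> bool \<Rightarrow> complex"

definition normalized1 :: "qubit \<Rightarrow> bool" where
  "normalized1 a \<longleftrightarrow> (\<Sum>i\<in>UNIV. (cmod (a i))\<^sup>2) = 1"

definition normalized3 :: "state3 \<Rightarrow> bool" where
  "normalized3 psi \<longleftrightarrow> (\<Sum>i\<in>UNIV. \<Sum>j\<in>UNIV. \<Sum>k\<in>UNIV. (cmod (psi i j k))\<^sup>2) = 1"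

definition overlap3 :: "qubit \<Rightarrow> qubit \<Rightarrow> qubit \<Rightarrow> state3 \<Rightarrow> complex" where
  "overlap3 a b c psi =
     (\<Sum>i\<in>UNIV. \<Sum>j\<in>UNIV. \<Sum>k\<in>UNIV. cnj (a i) * cnj (b j) * cnj (c k) * psi i j k)"

definition G3 :: "state3 \<Rightarrow> real" where
  "G3 psi = Sup {cmod (overlap3 a b c psi) | a b c.
                   normalized1 a \<and> normalized1 b \<and> normalized1 c}"

definition EG3 :: "state3 \<Rightarrow> real" where
  "EG3 psi = 1 - (G3 psi)\<^sup>2"

definition W_state :: state3 where
  "W_state i j k =
     (if (i \<and> \<not> j \<and> \<not> k) \<or> (\<not> i \<and> j \<and> \<not> k) \<or> (\<not> i \<and> \<not> j \<and> k)
      then complex_of_real (1 / sqrt 3) else 0)"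

text \<open>U is a 2x2 complex matrix, U r s = entry in row r column s; unitary means U^* U = I.\<close>
definition unitary2 :: "qmat \<Rightarrow> bool" where
  "unitary2 U \<longleftrightarrow> (\<forall>r s. (\<Sum>k\<in>UNIV. cnj (U k r) * U k s) = (if r = s then 1 else 0))"

definition local_apply :: "qmat \<Rightarrow> qmat \<Rightarrow> qmat \<Rightarrow> state3 \<Rightarrow> state3" where
  "local_apply U1 U2 U3 psi = (\<lambda>i j k.
     \<Sum>i'\<in>UNIV. \<Sum>j'\<in>UNIV. \<Sum>k'\<in>UNIV. U1 i i' * U2 j j' * U3 k k' * psi i' j' k')"

end

theory Submission
  imports Defs
begin

text \<open>Choose local bases in which a closest product state of psi is |000>. First-order
  optimality kills the coefficients of |100>, |010>, |001>, and after adjusting phases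
  psi = g (|000> + a|011> + b|101> + c|110> + d|111>) with g = G(psi), a, b, c >= 0 and d = u + iv.
  Contracting one qubit with (x, 1) leaves a 2x2 matrix whose largest singular value is at most
  g sqrt(1 + |x|^2). Its determinantal form is a real quadratic polynomial in (Re x, Im x), and
  nonnegativity of that polynomial says, with s = a^2 + b^2 + c^2 and A = 1 - s - 2abc,
  B = 1 - s + 2abc, that A >= 0 and u^2 / A + v^2 / B <= 1 (u = 0 if A = 0). So |d|^2 <= B, while A >= 0 and
  AM-GM give abc <= 1/8; hence 1/g^2 = 1 + s + |d|^2 <= 2 + 2abc <= 9/4.
  Equality forces a = b = c = 1/2, A = 0, u = 0 and v^2 = 1/2, which is the W state written in the
  basis of its own closest product state.\<close>

subsection \<open>Local unitaries and the maximal overlap\<close>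

lemma sum_bool: "(\<Sum>i\<in>UNIV. f i) = f False + f True" for f :: "bool \<Rightarrow> 'a::comm_monoid_add"
  by (simp add: UNIV_bool)

definition qnorm2 :: "qubit \<Rightarrow> real" where
  "qnorm2 a = (\<Sum>i\<in>UNIV. (cmod (a i))\<^sup>2)"

definition qmul :: "qmat \<Rightarrow> qmat \<Rightarrow> qmat" where
  "qmul U V = (\<lambda>i j. \<Sum>k\<in>UNIV. U i k * V k j)"

definition qadj :: "qmat \<Rightarrow> qmat" where
  "qadj U = (\<lambda>i j. cnj (U j i))"

definition qapp :: "qmat \<Rightarrow> qubit \<Rightarrow> qubit" where
  "qapp U a = (\<lambda>i. \<Sum>j\<in>UNIV. U i j * a j)"

lemma normalized1_iff: "normalized1 a \<longleftrightarrow> qnorm2 a = 1"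
  by (simp add: normalized1_def qnorm2_def)

lemma qnorm2_nonneg: "qnorm2 a \<ge> 0"
  by (simp add: qnorm2_def sum_nonneg)

lemma unitary2_iff: "unitary2 U \<longleftrightarrow> qmul (qadj U) U = (\<lambda>r s. if r = s then 1 else 0)"
  by (auto simp: unitary2_def qmul_def qadj_def fun_eq_iff)

text \<open>Since \<open>unitary2\<close> only says U^* U = I, this supplies U U^* = I and hence
  unitarity of the adjoint. For 2x2 matrices each entry of BA - I is a polynomial consequence of the
  four entry equations of AB = I.\<close>

lemma qmul_inverse_commute:
  assumes "qmul A B = (\<lambda>r s. if r = s then 1 else 0)"
  shows "qmul B A = (\<lambda>r s. if r = s then 1 else 0)"
proof -
  have e: "A r False * B False s + A r True * B True s = (if r = s then 1 else 0)" for r s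
    using fun_cong[OF fun_cong[OF assms, of r], of s] by (simp add: qmul_def sum_bool)
  note e' = e[of False False, simplified] e[of False True, simplified]
    e[of True False, simplified] e[of True True, simplified]
  have ff: "B False False * A False False + B False True * A True False = 1"
    using e' by algebra
  have ft: "B False False * A False True + B False True * A True True = 0"
    using e' by algebra
  have tf: "B True False * A False False + B True True * A True False = 0"
    using e' by algebra
  have tt: "B True False * A False True + B True True * A True True = 1"
    using e' by algebra
  show ?thesis
  proof (intro ext)
    fix r s :: bool
    show "qmul B A r s = (if r = s then 1 else 0)"
      using ff ft tf tt by (cases r; cases s; simp add: qmul_def sum_bool)
  qed
qed

lemma unitary2_qadj: "unitary2 U \<Longrightarrow> unitary2 (qadj U)"
proof -
  assume "unitary2 U"
  hence "qmul U (qadj U) = (\<lambda>r s. if r = s then 1 else 0)"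
    unfolding unitary2_iff by (rule qmul_inverse_commute)
  moreover have "qadj (qadj U) = U" by (simp add: qadj_def)
  ultimately show ?thesis by (simp add: unitary2_iff)
qed

lemma qnorm2_qapp:
  assumes "unitary2 U"
  shows "qnorm2 (qapp U a) = qnorm2 a"
proof -
  have e: "cnj (U False r) * U False s + cnj (U True r) * U True s = (if r = s then 1 else 0)" for r s
    using assms by (simp add: unitary2_def sum_bool)
  note e' = e[of False False, simplified] e[of False True, simplified]
    e[of True False, simplified] e[of True True, simplified]
  \<comment> \<open>Over the complex numbers |z|^2 = z cnj z, so the claim becomes a polynomial
    identity modulo the unitarity relations.\<close>
  have "complex_of_real (qnorm2 (qapp U a)) = complex_of_real (qnorm2 a)"
    unfolding qnorm2_def qapp_def sum_bool of_real_add complex_norm_square complex_cnj_add complex_cnj_mult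
    using e' by algebra
  thus ?thesis using of_real_eq_iff by blast
qed

lemma unitary2_qmul:
  assumes "unitary2 U" "unitary2 V"
  shows "unitary2 (qmul U V)"
proof -
  have e: "cnj (U False r) * U False s + cnj (U True r) * U True s = (if r = s then 1 else 0)" for r s
    using assms by (simp add: unitary2_def sum_bool)
  have f: "cnj (V False r) * V False s + cnj (V True r) * V True s = (if r = s then 1 else 0)" for r s
    using assms by (simp add: unitary2_def sum_bool)
  note e' = e[of False False, simplified] e[of False True, simplified]
    e[of True False, simplified] e[of True True, simplified]
  show ?thesis
    unfolding unitary2_def qmul_def sum_bool complex_cnj_add complex_cnj_mult
  proof (intro allI)
    fix r s
    show "(cnj (U False False) * cnj (V False r) + cnj (U False True) * cnj (V True r)) *
            (U False False * V False s + U False True * V True s) +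
          (cnj (U True False) * cnj (V False r) + cnj (U True True) * cnj (V True r)) *
            (U True False * V False s + U True True * V True s) = (if r = s then 1 else 0)"
      unfolding f[of r s, symmetric] using e' by algebra
  qed
qed

lemma local_apply_nested:
  "local_apply U1 U2 U3 psi i j k = (\<Sum>i'\<in>UNIV. U1 i i' * (\<Sum>j'\<in>UNIV. U2 j j' * (\<Sum>k'\<in>UNIV. U3 k k' * psi i' j' k')))"
  by (simp add: local_apply_def sum_bool algebra_simps)

lemma local_apply_local_apply:
  "local_apply U1 U2 U3 (local_apply V1 V2 V3 psi) =
    local_apply (qmul U1 V1) (qmul U2 V2) (qmul U3 V3) psi"
  by (intro ext) (simp add: local_apply_nested qmul_def sum_bool algebra_simps)

lemma local_apply_scale:
  "local_apply U1 U2 U3 (\<lambda>i j k. w * psi i j k) = (\<lambda>i j k. w * local_apply U1 U2 U3 psi i j k)"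
  by (intro ext) (simp add: local_apply_nested sum_bool algebra_simps)

lemma local_apply_id:
  "local_apply (\<lambda>r s. if r = s then 1 else 0) (\<lambda>r s. if r = s then 1 else 0)
     (\<lambda>r s. if r = s then 1 else 0) psi = psi"
  by (intro ext) (auto simp: local_apply_nested sum_bool)

lemma overlap3_local_apply:
  "overlap3 a b c (local_apply U1 U2 U3 psi) =
    overlap3 (qapp (qadj U1) a) (qapp (qadj U2) b) (qapp (qadj U3) c) psi"
  by (simp add: overlap3_def local_apply_nested qapp_def qadj_def sum_bool algebra_simps)

lemma overlap3_scale: "overlap3 a b c (\<lambda>i j k. w * psi i j k) = w * overlap3 a b c psi"
  by (simp add: overlap3_def sum_bool algebra_simps)

lemma overlap3_scale_args:
  "overlap3 (\<lambda>i. x * a i) (\<lambda>i. y * b i) (\<lambda>i. z * c i) psi = cnj x * cnj y * cnj z * overlap3 a b c psi"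
  by (simp add: overlap3_def sum_bool algebra_simps)

definition snorm2 :: "state3 \<Rightarrow> real" where
  "snorm2 psi = (\<Sum>i\<in>UNIV. \<Sum>j\<in>UNIV. \<Sum>k\<in>UNIV. (cmod (psi i j k))\<^sup>2)"

text \<open>The factors act one after another: with two of the three indices frozen, each is an
  isometry of a single qubit. \<open>g\<close> and \<open>h\<close> are the states after applying
  \<open>U3\<close>, and then also \<open>U2\<close>.\<close>

lemma snorm2_local_apply:
  assumes "unitary2 U1" "unitary2 U2" "unitary2 U3"
  shows "snorm2 (local_apply U1 U2 U3 psi) = snorm2 psi"
proof -
  have n: "(\<Sum>i\<in>UNIV. (cmod (\<Sum>j\<in>UNIV. U i j * f j))\<^sup>2) = (\<Sum>i\<in>UNIV. (cmod (f i))\<^sup>2)"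
    if "unitary2 U" for U f
    using qnorm2_qapp[OF that, of f] by (simp add: qnorm2_def qapp_def)
  define g where "g = (\<lambda>k i' j'. \<Sum>k'\<in>UNIV. U3 k k' * psi i' j' k')"
  define h where "h = (\<lambda>j k i'. \<Sum>j'\<in>UNIV. U2 j j' * g k i' j')"
  have "snorm2 (local_apply U1 U2 U3 psi) = (\<Sum>j\<in>UNIV. \<Sum>k\<in>UNIV. \<Sum>i\<in>UNIV. (cmod (\<Sum>i'\<in>UNIV. U1 i i' * h j k i'))\<^sup>2)"
    by (simp add: snorm2_def local_apply_nested g_def h_def sum_bool)
  also have "\<dots> = (\<Sum>j\<in>UNIV. \<Sum>k\<in>UNIV. \<Sum>i\<in>UNIV. (cmod (h j k i))\<^sup>2)"
    by (simp only: n[OF assms(1)])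
  also have "\<dots> = (\<Sum>k\<in>UNIV. \<Sum>i\<in>UNIV. \<Sum>j\<in>UNIV. (cmod (\<Sum>j'\<in>UNIV. U2 j j' * g k i j'))\<^sup>2)"
    by (simp add: h_def sum_bool)
  also have "\<dots> = (\<Sum>k\<in>UNIV. \<Sum>i\<in>UNIV. \<Sum>j\<in>UNIV. (cmod (g k i j))\<^sup>2)"
    by (simp only: n[OF assms(2)])
  also have "\<dots> = (\<Sum>i\<in>UNIV. \<Sum>j\<in>UNIV. \<Sum>k\<in>UNIV. (cmod (\<Sum>k'\<in>UNIV. U3 k k' * psi i j k'))\<^sup>2)"
    by (simp add: g_def sum_bool)
  also have "\<dots> = snorm2 psi"
    by (simp only: n[OF assms(3)] snorm2_def)
  finally show ?thesis .
qed

text \<open>The phase is kept as a number of modulus one, which makes composition and inversion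
  immediate.\<close>

definition lu_equiv :: "state3 \<Rightarrow> state3 \<Rightarrow> bool" where
  "lu_equiv psi chi \<longleftrightarrow> (\<exists>U1 U2 U3 w. unitary2 U1 \<and> unitary2 U2 \<and> unitary2 U3 \<and> cmod w = 1 \<and>
     psi = (\<lambda>i j k. w * local_apply U1 U2 U3 chi i j k))"

lemma lu_equivI:
  assumes "unitary2 U1" "unitary2 U2" "unitary2 U3" "cmod w = 1"
    and "\<And>i j k. psi i j k = w * local_apply U1 U2 U3 chi i j k"
  shows "lu_equiv psi chi"
  using assms unfolding lu_equiv_def by blast

lemma lu_equiv_trans:
  assumes "lu_equiv psi chi" "lu_equiv chi xi"
  shows "lu_equiv psi xi"
proof -
  obtain U1 U2 U3 w where u: "unitary2 U1" "unitary2 U2" "unitary2 U3" "cmod w = 1"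
    "psi = (\<lambda>i j k. w * local_apply U1 U2 U3 chi i j k)"
    using assms(1) unfolding lu_equiv_def by blast
  obtain V1 V2 V3 z where v: "unitary2 V1" "unitary2 V2" "unitary2 V3" "cmod z = 1"
    "chi = (\<lambda>i j k. z * local_apply V1 V2 V3 xi i j k)"
    using assms(2) unfolding lu_equiv_def by blast
  show ?thesis
    by (rule lu_equivI[of "qmul U1 V1" "qmul U2 V2" "qmul U3 V3" "w * z"])
      (use u v in \<open>simp_all add: unitary2_qmul norm_mult local_apply_scale local_apply_local_apply\<close>)
qed

lemma lu_equiv_sym:
  assumes "lu_equiv psi chi"
  shows "lu_equiv chi psi"
proof -
  obtain U1 U2 U3 w where u: "unitary2 U1" "unitary2 U2" "unitary2 U3" "cmod w = 1"
    "psi = (\<lambda>i j k. w * local_apply U1 U2 U3 chi i j k)"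
    using assms(1) unfolding lu_equiv_def by blast
  have "w \<noteq> 0" using u(4) by auto
  show ?thesis
    by (rule lu_equivI[of "qadj U1" "qadj U2" "qadj U3" "inverse w"])
      (use u(1-4) \<open>w \<noteq> 0\<close> in \<open>simp_all add: unitary2_qadj norm_inverse u(5) local_apply_scale
         local_apply_local_apply unitary2_iff[THEN iffD1] local_apply_id\<close>)
qed

lemma lu_equiv_snorm2:
  assumes "lu_equiv psi chi"
  shows "snorm2 psi = snorm2 chi"
proof -
  obtain U1 U2 U3 w where u: "unitary2 U1" "unitary2 U2" "unitary2 U3" "cmod w = 1"
    "psi = (\<lambda>i j k. w * local_apply U1 U2 U3 chi i j k)"
    using assms(1) unfolding lu_equiv_def by blast
  have "snorm2 psi = snorm2 (local_apply U1 U2 U3 chi)"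
    by (simp add: snorm2_def u(4,5) norm_mult)
  thus ?thesis using snorm2_local_apply[OF u(1-3)] by simp
qed

section \<open>The maximal overlap: attainment, homogeneous bound, local unitary invariance\<close>

lemma continuous_on_overlap3:
  "continuous_on S (\<lambda>p. overlap3 (\<lambda>i. if i then snd (fst p) else fst (fst p))
     (\<lambda>i. if i then snd (fst (snd p)) else fst (fst (snd p)))
     (\<lambda>i. if i then snd (snd (snd p)) else fst (snd (snd p))) psi)"
  by (simp add: overlap3_def sum_bool) (intro continuous_intros)

lemma qnorm2_pair: "qnorm2 (\<lambda>i. if i then y else x) = (norm (x, y))\<^sup>2"
  by (simp add: qnorm2_def sum_bool norm_Pair)

text \<open>Encoding qubits as pairs of complex numbers turns normalized vectors into a unit sphere,
  so a continuous function is maximized over a product of three compact spheres.\<close>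

lemma overlap3_attains_max:
  obtains a b c where "normalized1 a" "normalized1 b" "normalized1 c"
    "\<And>a' b' c'. normalized1 a' \<Longrightarrow> normalized1 b' \<Longrightarrow> normalized1 c' \<Longrightarrow>
       cmod (overlap3 a' b' c' psi) \<le> cmod (overlap3 a b c psi)"
proof -
  let ?q = "\<lambda>p::complex\<times>complex. \<lambda>i. if i then snd p else fst p"
  let ?S = "sphere 0 1 :: (complex \<times> complex) set"
  let ?f = "\<lambda>p. cmod (overlap3 (?q (fst p)) (?q (fst (snd p))) (?q (snd (snd p))) psi)"
  have cp: "compact (?S \<times> ?S \<times> ?S)" by (intro compact_Times compact_sphere)
  have "(1,0) \<in> ?S" by simp
  hence ne: "?S \<times> ?S \<times> ?S \<noteq> {}" by blast
  have "continuous_on (?S \<times> ?S \<times> ?S) ?f"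
    by (intro continuous_on_norm continuous_on_overlap3)
  from continuous_attains_sup[OF cp ne this] obtain p where
    p: "p \<in> ?S \<times> ?S \<times> ?S" "\<And>p'. p' \<in> ?S \<times> ?S \<times> ?S \<Longrightarrow> ?f p' \<le> ?f p" by blast
  have nq: "normalized1 (?q r) \<longleftrightarrow> r \<in> ?S" for r
    using qnorm2_pair[of "snd r" "fst r"] by (simp add: normalized1_iff abs_square_eq_1)
  have eq: "(\<lambda>i. if i then a True else a False) = a" for a :: qubit by auto
  show ?thesis
  proof
    show "normalized1 (?q (fst p))" "normalized1 (?q (fst (snd p)))" "normalized1 (?q (snd (snd p)))"
      using p(1) unfolding nq by auto
  next
    fix a' b' c' assume n: "normalized1 a'" "normalized1 b'" "normalized1 c'"
    let ?p = "((a' False, a' True), (b' False, b' True), (c' False, c' True))"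
    have "?p \<in> ?S \<times> ?S \<times> ?S"
      using n nq[of "(a' False, a' True)"] nq[of "(b' False, b' True)"] nq[of "(c' False, c' True)"]
      unfolding fst_conv snd_conv eq by simp
    from p(2)[OF this] show "cmod (overlap3 a' b' c' psi)
      \<le> cmod (overlap3 (?q (fst p)) (?q (fst (snd p))) (?q (snd (snd p))) psi)"
      by (simp only: fst_conv snd_conv eq)
  qed
qed

lemma G3_eqI:
  assumes "normalized1 a" "normalized1 b" "normalized1 c" "cmod (overlap3 a b c psi) = g"
    "\<And>a b c. normalized1 a \<Longrightarrow> normalized1 b \<Longrightarrow> normalized1 c \<Longrightarrow> cmod (overlap3 a b c psi) \<le> g"
  shows "G3 psi = g"
  unfolding G3_def by (rule cSup_eq_maximum) (use assms in blast)+

lemma G3_attained: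
  obtains a b c where "normalized1 a" "normalized1 b" "normalized1 c"
    "G3 psi = cmod (overlap3 a b c psi)"
  by (metis G3_eqI overlap3_attains_max)

lemma overlap3_le_G3:
  assumes "normalized1 a" "normalized1 b" "normalized1 c"
  shows "cmod (overlap3 a b c psi) \<le> G3 psi"
  by (metis G3_eqI overlap3_attains_max assms)

lemma G3_nonneg: "G3 psi \<ge> 0"
  by (metis G3_attained norm_ge_zero)

text \<open>Homogeneous form of the definition of G, so that unnormalized test vectors can be
  inserted later. Nonzero vectors are rescaled; a zero vector makes the overlap vanish.\<close>

lemma overlap3_bound:
  "(cmod (overlap3 a b c psi))\<^sup>2 \<le> (G3 psi)\<^sup>2 * qnorm2 a * qnorm2 b * qnorm2 c"
proof (cases "qnorm2 a = 0 \<or> qnorm2 b = 0 \<or> qnorm2 c = 0")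
  case True
  have "qnorm2 x = 0 \<Longrightarrow> x = (\<lambda>_. 0)" for x
    by (auto simp: qnorm2_def sum_bool add_nonneg_eq_0_iff fun_eq_iff) (metis (full_types))
  with True have "a = (\<lambda>_. 0) \<or> b = (\<lambda>_. 0) \<or> c = (\<lambda>_. 0)" by blast
  hence "overlap3 a b c psi = 0" by (auto simp: overlap3_def)
  thus ?thesis by (simp add: qnorm2_nonneg)
next
  case False
  define n where "n = (\<lambda>x. complex_of_real (1 / sqrt (qnorm2 x)))"
  have pos: "qnorm2 a > 0" "qnorm2 b > 0" "qnorm2 c > 0"
    using False qnorm2_nonneg by (metis less_eq_real_def)+
  have cn: "(cmod (n x))\<^sup>2 = 1 / qnorm2 x" if "qnorm2 x > 0" for x
    using that by (simp add: n_def power_divide norm_divide)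
  have nm: "normalized1 (\<lambda>i. n x * x i)" if "qnorm2 x > 0" for x
  proof -
    have "qnorm2 (\<lambda>i. n x * x i) = (cmod (n x))\<^sup>2 * qnorm2 x"
      by (simp add: qnorm2_def norm_mult power_mult_distrib sum_distrib_left)
    thus ?thesis using that by (simp add: normalized1_iff cn)
  qed
  have "(cmod (overlap3 (\<lambda>i. n a * a i) (\<lambda>i. n b * b i) (\<lambda>i. n c * c i) psi))\<^sup>2 \<le> (G3 psi)\<^sup>2"
    by (intro power_mono overlap3_le_G3 nm pos norm_ge_zero)
  hence "(cmod (overlap3 a b c psi))\<^sup>2 / (qnorm2 a * qnorm2 b * qnorm2 c) \<le> (G3 psi)\<^sup>2"
    by (simp add: overlap3_scale_args norm_mult power_mult_distrib cn pos)
  thus ?thesis using pos by (simp add: field_simps)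
qed

text \<open>A maximizer for \<open>psi\<close>, moved by the adjoint unitaries, is an admissible
  competitor for \<open>chi\<close> with the same overlap modulus.\<close>

lemma lu_equiv_G3_le:
  assumes "lu_equiv psi chi"
  shows "G3 psi \<le> G3 chi"
proof -
  obtain U1 U2 U3 w where u: "unitary2 U1" "unitary2 U2" "unitary2 U3" "cmod w = 1"
    "psi = (\<lambda>i j k. w * local_apply U1 U2 U3 chi i j k)"
    using assms(1) unfolding lu_equiv_def by blast
  obtain a b c where n: "normalized1 a" "normalized1 b" "normalized1 c"
    "G3 psi = cmod (overlap3 a b c psi)" by (rule G3_attained)
  have "cmod (overlap3 a b c psi) = cmod (overlap3 (qapp (qadj U1) a) (qapp (qadj U2) b) (qapp (qadj U3) c) chi)"
    by (simp add: u(4,5) overlap3_scale overlap3_local_apply norm_mult)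
  also have "\<dots> \<le> G3 chi"
    by (rule overlap3_le_G3) (use n u in \<open>simp_all add: normalized1_iff qnorm2_qapp unitary2_qadj\<close>)
  finally show ?thesis using n(4) by simp
qed

lemma lu_equiv_G3: "lu_equiv psi chi \<Longrightarrow> G3 psi = G3 chi"
  using lu_equiv_G3_le lu_equiv_sym by (metis order_antisym)

subsection \<open>Real inequalities\<close>

lemma quadratic_nonneg_real:
  fixes A B C :: real
  assumes "\<And>p. A * p\<^sup>2 - 2 * B * p + C \<ge> 0"
  shows "A \<ge> 0" "B\<^sup>2 \<le> A * C"
proof -
  have C: "C \<ge> 0" using assms[of 0] by simp
  show A: "A \<ge> 0"
  proof (rule ccontr)
    assume n: "\<not> A \<ge> 0"
    \<comment> \<open>For A < 0 this point is at least 1 and so far out that A p - 2B < -C - 1,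
      which makes the quadratic negative.\<close>
    define p where "p = (\<bar>B\<bar> * 2 + C + 1) / (- A) + 1"
    have p1: "p \<ge> 1" using n C by (simp add: p_def field_simps)
    have "- A * (p - 1) = \<bar>B\<bar> * 2 + C + 1" using n by (simp add: p_def)
    hence Ap: "A * p < - (\<bar>B\<bar> * 2 + C + 1)" using n by (simp add: algebra_simps)
    define r where "r = A * p - 2 * B"
    have "r < - C - 1" using Ap by (simp add: r_def)
    hence "p * r \<le> p * (- C - 1)" using p1 by (intro mult_left_mono) auto
    also have "\<dots> \<le> 1 * (- C - 1)" using p1 C by (intro mult_right_mono_neg) auto
    finally have "p * r + C < 0" by simp
    moreover have "A * p\<^sup>2 - 2 * B * p + C = p * r + C"
      by (simp add: r_def algebra_simps power2_eq_square)
    ultimately show False using assms[of p] by simp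
  qed
  show "B\<^sup>2 \<le> A * C"
  proof (cases "A = 0")
    case True
    have "B = 0"
    proof (rule ccontr)
      assume "B \<noteq> 0"
      \<comment> \<open>With A = 0 this argument gives the value -1.\<close>
      thus False using assms[of "(C + 1) / (2 * B)"] True by simp
    qed
    thus ?thesis using True by simp
  next
    case False
    hence "A > 0" using A by simp
    have "A * (B / A)\<^sup>2 - 2 * B * (B / A) + C = C - B\<^sup>2 / A"
      using False by (simp add: field_simps power2_eq_square)
    hence "C \<ge> B\<^sup>2 / A" using assms[of "B / A"] by simp
    thus ?thesis using \<open>A > 0\<close> by (simp add: field_simps)
  qed
qed

text \<open>The conclusion is det (L I - M^* M) for the matrix M of the bilinear form.\<close>
lemma bilinear_bound_det:
  fixes m00 m01 m10 m11 :: complex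
  assumes "\<And>a0 a1 b0 b1. (cmod (a0 * (m00 * b0 + m01 * b1) + a1 * (m10 * b0 + m11 * b1)))\<^sup>2
     \<le> L * ((cmod a0)\<^sup>2 + (cmod a1)\<^sup>2) * ((cmod b0)\<^sup>2 + (cmod b1)\<^sup>2)"
  shows "L\<^sup>2 - L * ((cmod m00)\<^sup>2 + (cmod m01)\<^sup>2 + (cmod m10)\<^sup>2 + (cmod m11)\<^sup>2)
      + (cmod (m00 * m11 - m01 * m10))\<^sup>2 \<ge> 0"
proof -
  \<comment> \<open>Taking for a the conjugate of M b turns the bilinear bound into |M b|^4 <= L |M
    b|^2 |b|^2, and one factor |M b|^2 cancels.\<close>
  have M: "(cmod (m00 * b0 + m01 * b1))\<^sup>2 + (cmod (m10 * b0 + m11 * b1))\<^sup>2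
     \<le> L * ((cmod b0)\<^sup>2 + (cmod b1)\<^sup>2)" for b0 b1
  proof -
    define x y where "x = m00 * b0 + m01 * b1" and "y = m10 * b0 + m11 * b1"
    define N where "N = (cmod x)\<^sup>2 + (cmod y)\<^sup>2"
    have "cnj x * x + cnj y * y = complex_of_real N"
      by (simp only: N_def of_real_add complex_norm_square mult.commute)
    hence "(cmod (complex_of_real N))\<^sup>2 \<le> L * N * ((cmod b0)\<^sup>2 + (cmod b1)\<^sup>2)"
      using assms[of "cnj x" b0 b1 "cnj y", folded x_def y_def]
      by (simp only: N_def complex_mod_cnj)
    hence "N\<^sup>2 \<le> L * N * ((cmod b0)\<^sup>2 + (cmod b1)\<^sup>2)" by simp
    hence a: "N * N \<le> N * (L * ((cmod b0)\<^sup>2 + (cmod b1)\<^sup>2))"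
      by (simp add: power2_eq_square algebra_simps)
    have N0: "N \<ge> 0" by (simp add: N_def)
    have L0: "L \<ge> 0" using order.trans[OF zero_le_power2 assms[of 1 0 1 0]] by simp
    show ?thesis
    proof (cases "N = 0")
      case True thus ?thesis using L0 by (simp add: N_def x_def y_def)
    next
      case False
      hence "N > 0" using N0 by simp
      hence "N \<le> L * ((cmod b0)\<^sup>2 + (cmod b1)\<^sup>2)" using a by simp
      thus ?thesis by (simp add: N_def x_def y_def)
    qed
  qed
  \<comment> \<open>Diagonal entries of L I - M^* M; up to sign and conjugation
    \<open>\<beta>\<close> is its off-diagonal entry.\<close>
  define \<alpha> \<gamma> where "\<alpha> = L - (cmod m00)\<^sup>2 - (cmod m10)\<^sup>2" and "\<gamma> = L - (cmod m01)\<^sup>2 - (cmod m11)\<^sup>2"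
  define \<beta> where "\<beta> = m00 * cnj m01 + m10 * cnj m11"
  have g0: "\<alpha> \<ge> 0" "\<gamma> \<ge> 0" using M[of 1 0] M[of 0 1] by (simp_all add: \<alpha>_def \<gamma>_def)
  \<comment> \<open>On the vector (s, t \<beta>) the cross term of the Hermitian form is real, so
    the real discriminant criterion applies.\<close>
  have Q: "\<alpha> * s\<^sup>2 - 2 * (cmod \<beta>)\<^sup>2 * s * t + \<gamma> * (cmod \<beta>)\<^sup>2 * t\<^sup>2 \<ge> 0" for s t :: real
  proof -
    have "\<alpha> * s\<^sup>2 - 2 * (cmod \<beta>)\<^sup>2 * s * t + \<gamma> * (cmod \<beta>)\<^sup>2 * t\<^sup>2 =
      L * ((cmod (of_real s))\<^sup>2 + (cmod (of_real t * \<beta>))\<^sup>2) - ((cmod (m00 * of_real s + m01 * (of_real t * \<beta>)))\<^sup>2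
        + (cmod (m10 * of_real s + m11 * (of_real t * \<beta>)))\<^sup>2)"
      unfolding cmod_power2 \<alpha>_def \<beta>_def \<gamma>_def
      by (simp add: power2_eq_square) algebra
    thus ?thesis using M[of "of_real s" "of_real t * \<beta>"] by simp
  qed
  have "\<alpha> * \<gamma> \<ge> (cmod \<beta>)\<^sup>2"
  proof -
    have "((cmod \<beta>)\<^sup>2)\<^sup>2 \<le> \<gamma> * (cmod \<beta>)\<^sup>2 * \<alpha>"
      by (rule quadratic_nonneg_real(2)) (use Q[of 1] in \<open>simp add: algebra_simps\<close>)
    hence "(cmod \<beta>)\<^sup>2 * (cmod \<beta>)\<^sup>2 \<le> (cmod \<beta>)\<^sup>2 * (\<alpha> * \<gamma>)"
      by (simp add: power2_eq_square algebra_simps)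
    moreover have "(cmod \<beta>)\<^sup>2 > 0" if "\<beta> \<noteq> 0" using that by simp
    ultimately show ?thesis using g0 mult_left_le_imp_le by (cases "\<beta> = 0") (simp, blast)
  qed
  moreover have "\<alpha> * \<gamma> - (cmod \<beta>)\<^sup>2 = L\<^sup>2 - L * ((cmod m00)\<^sup>2 + (cmod m01)\<^sup>2 + (cmod m10)\<^sup>2 + (cmod m11)\<^sup>2)
      + (cmod (m00 * m11 - m01 * m10))\<^sup>2"
    unfolding cmod_power2 \<alpha>_def \<beta>_def \<gamma>_def by (simp add: power2_eq_square) algebra
  ultimately show ?thesis by linarith
qed

text \<open>The discriminant criterion is used twice: eliminating p leaves an inequality that is
  again a quadratic in q, of leading coefficient A B after rearrangement.\<close>

lemma two_variable_quadratic:
  fixes A B K e f :: real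
  assumes "\<And>p q. A * p\<^sup>2 + B * q\<^sup>2 - 2 * e * p - 2 * f * q + K \<ge> 0"
  shows "A \<ge> 0" "A = 0 \<Longrightarrow> e = 0" "f\<^sup>2 \<le> B * K"
    "A > 0 \<Longrightarrow> A * f\<^sup>2 + B * e\<^sup>2 \<le> A * B * K"
proof -
  have 1: "A * p\<^sup>2 - 2 * e * p + (B * q\<^sup>2 - 2 * f * q + K) \<ge> 0" for p q
    using assms[of p q] by (simp add: algebra_simps)
  have 2: "B * q\<^sup>2 - 2 * f * q + K \<ge> 0" for q
    using 1[of 0 q] by simp
  show "A \<ge> 0" using quadratic_nonneg_real(1)[OF 1[of _ 0]] by simp
  show "f\<^sup>2 \<le> B * K" by (rule quadratic_nonneg_real(2)[OF 2])
  have 3: "e\<^sup>2 \<le> A * (B * q\<^sup>2 - 2 * f * q + K)" for q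
    by (rule quadratic_nonneg_real(2)[OF 1])
  show "A = 0 \<Longrightarrow> e = 0" using 3[of 0] by simp
  assume "A > 0"
  have "(A * f)\<^sup>2 \<le> (A * B) * (A * K - e\<^sup>2)"
  proof (rule quadratic_nonneg_real(2))
    fix q show "A * B * q\<^sup>2 - 2 * (A * f) * q + (A * K - e\<^sup>2) \<ge> 0"
      using 3[of q] by (simp add: algebra_simps)
  qed
  hence "A * (A * f\<^sup>2 + B * e\<^sup>2) \<le> A * (A * B * K)"
    by (simp add: algebra_simps power2_eq_square)
  thus "A * f\<^sup>2 + B * e\<^sup>2 \<le> A * B * K" using \<open>A > 0\<close> by simp
qed

text \<open>AM-GM on the squares gives 27 m^2 <= s^3, so m >= 1/8 forces s >= 3/4, and s + 2m <= 1
  then leaves only m = 1/8. In that case AM-GM is tight and the squares coincide.\<close>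

lemma sum_le_one_prod_le:
  fixes a b c :: real
  assumes "a \<ge> 0" "b \<ge> 0" "c \<ge> 0" "a\<^sup>2 + b\<^sup>2 + c\<^sup>2 + 2 * a * b * c \<le> 1"
  shows "a * b * c \<le> 1/8" "a * b * c = 1/8 \<Longrightarrow> a = 1/2 \<and> b = 1/2 \<and> c = 1/2"
proof -
  define X Y Z s m where "X = a\<^sup>2" and "Y = b\<^sup>2" and "Z = c\<^sup>2" and "s = X + Y + Z" and "m = a * b * c"
  have nn: "X \<ge> 0" "Y \<ge> 0" "Z \<ge> 0" "s \<ge> 0" by (simp_all add: X_def Y_def Z_def s_def)
  have m2: "m\<^sup>2 = X * Y * Z" by (simp add: m_def X_def Y_def Z_def power_mult_distrib)
  have sm: "s + 2 * m \<le> 1" using assms(4) by (simp add: s_def m_def X_def Y_def Z_def)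
  \<comment> \<open>The AM-GM deficit s^3 - 27 XYZ equals S + 3T with both parts nonnegative; for s
    > 0, S = 0 already gives X = Y = Z.\<close>
  define S T where "S = s / 2 * ((X - Y)\<^sup>2 + (Y - Z)\<^sup>2 + (Z - X)\<^sup>2)"
    and "T = X * (Y - Z)\<^sup>2 + Y * (Z - X)\<^sup>2 + Z * (X - Y)\<^sup>2"
  have "S = (X + Y + Z) * (X\<^sup>2 + Y\<^sup>2 + Z\<^sup>2 - X * Y - Y * Z - Z * X)"
    unfolding S_def s_def by (simp add: field_simps power2_eq_square)
  hence id: "s^3 - 27 * m\<^sup>2 = S + 3 * T"
    unfolding m2 s_def T_def by algebra
  have p: "T \<ge> 0"
    using nn unfolding T_def by (intro add_nonneg_nonneg mult_nonneg_nonneg) auto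
  have p': "S \<ge> 0"
    using nn unfolding S_def by (intro mult_nonneg_nonneg) auto
  have am: "27 * m\<^sup>2 \<le> s^3" using id p p' by linarith
  have s34: "s \<ge> 3/4" if "m \<ge> 1/8"
  proof (rule ccontr)
    assume "\<not> s \<ge> 3/4"
    hence "s^3 < (3/4)^3" using nn by (intro power_strict_mono) auto
    moreover have "(1/8)\<^sup>2 \<le> m\<^sup>2" using that by (intro power_mono) auto
    ultimately show False using am by (simp add: power2_eq_square power3_eq_cube)
  qed
  show le: "a * b * c \<le> 1/8"
  proof (rule ccontr)
    assume "\<not> ?thesis"
    hence "m > 1/8" by (simp add: m_def)
    thus False using s34 sm by linarith
  qed
  assume "a * b * c = 1/8"
  hence m: "m = 1/8" by (simp add: m_def)
  hence s: "s = 3/4" using s34 sm by linarith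
  have "s^3 - 27 * m\<^sup>2 = 0" unfolding s m by (simp add: power2_eq_square power3_eq_cube)
  hence "S = 0" using id p p' by linarith
  hence z: "(X - Y)\<^sup>2 + (Y - Z)\<^sup>2 + (Z - X)\<^sup>2 = 0" by (simp add: s S_def)
  have "X - Y = 0" "Y - Z = 0" using z by (smt (verit) zero_le_power2 power2_eq_square mult_eq_0_iff)+
  hence "X = 1/4" "Y = 1/4" "Z = 1/4" using s by (simp_all add: s_def)
  hence "a\<^sup>2 = (1/2)\<^sup>2" "b\<^sup>2 = (1/2)\<^sup>2" "c\<^sup>2 = (1/2)\<^sup>2" by (simp_all add: X_def Y_def Z_def power2_eq_square)
  thus "a = 1/2 \<and> b = 1/2 \<and> c = 1/2" using assms by (simp add: power2_eq_iff_nonneg)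
qed

text \<open>The quantity in bilinear_bound_det for the matrix with rows (x, a) and
  (b, c x + u + i v), where x = p + i q and L = 1 + |x|^2. The matrix is what remains of the
  canonical state with leading coefficient 1 after contracting one qubit with (x, 1).\<close>
definition slice_form :: "real \<Rightarrow> real \<Rightarrow> real \<Rightarrow> real \<Rightarrow> real \<Rightarrow> real \<Rightarrow> real \<Rightarrow> real" where
  "slice_form a b c u v p q = (1 - a\<^sup>2 - b\<^sup>2 - c\<^sup>2 - 2*a*b*c) * p\<^sup>2 + (1 - a\<^sup>2 - b\<^sup>2 - c\<^sup>2 + 2*a*b*c) * q\<^sup>2
     - 2 * (u * (c + a*b)) * p - 2 * (v * (c - a*b)) * q + ((1 - a\<^sup>2) * (1 - b\<^sup>2) - u\<^sup>2 - v\<^sup>2)"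

text \<open>The constant term contains P = (1 - a^2)(1 - b^2) = A + (c + ab)^2 = B + (c - ab)^2.
  Substituting this into the discriminant inequality makes P a common factor and leaves A v^2 + B
  u^2 <= A B; then A <= B bounds |d|^2 by B. The degenerate case A = 0 draws on all three
  rotations.\<close>

lemma slice_form_bound:
  fixes a b c u v :: real
  assumes "a \<ge> 0" "b \<ge> 0" "c \<ge> 0"
    and F: "\<And>p q. slice_form a b c u v p q \<ge> 0" "\<And>p q. slice_form b c a u v p q \<ge> 0"
      "\<And>p q. slice_form c a b u v p q \<ge> 0"
  shows "a\<^sup>2 + b\<^sup>2 + c\<^sup>2 + 2*a*b*c \<le> 1"
    "a\<^sup>2 + b\<^sup>2 + c\<^sup>2 + 2*a*b*c = 1 \<Longrightarrow> u = 0"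
    "u\<^sup>2 + v\<^sup>2 \<le> 1 - a\<^sup>2 - b\<^sup>2 - c\<^sup>2 + 2*a*b*c"
proof -
  define A where "A = 1 - a\<^sup>2 - b\<^sup>2 - c\<^sup>2 - 2*a*b*c"
  define B where "B = 1 - a\<^sup>2 - b\<^sup>2 - c\<^sup>2 + 2*a*b*c"
  txt \<open>A and B do not change when a, b, c are permuted cyclically, so each of the three
    forms gives the same statement with the roles of a, b, c rotated.\<close>
  have R: "A \<ge> 0 \<and> (A = 0 \<longrightarrow> u * (z + x*y) = 0 \<and> v\<^sup>2 * (z - x*y)\<^sup>2 \<le> B * ((1 - x\<^sup>2) * (1 - y\<^sup>2) - u\<^sup>2 - v\<^sup>2)) \<and>
     (A > 0 \<longrightarrow> A * (v\<^sup>2 * (z - x*y)\<^sup>2) + B * (u\<^sup>2 * (z + x*y)\<^sup>2) \<le> A * B * ((1 - x\<^sup>2) * (1 - y\<^sup>2) - u\<^sup>2 - v\<^sup>2))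
     \<and> (1 - x\<^sup>2) * (1 - y\<^sup>2) = A + (z + x*y)\<^sup>2 \<and> (1 - x\<^sup>2) * (1 - y\<^sup>2) = B + (z - x*y)\<^sup>2"
    if "\<And>p q. slice_form x y z u v p q \<ge> 0" and "(x,y,z) \<in> {(a,b,c),(b,c,a),(c,a,b)}" for x y z
  proof -
    have e: "1 - x\<^sup>2 - y\<^sup>2 - z\<^sup>2 - 2*x*y*z = A" "1 - x\<^sup>2 - y\<^sup>2 - z\<^sup>2 + 2*x*y*z = B"
      using that(2) by (auto simp: A_def B_def algebra_simps)
    have "A * p\<^sup>2 + B * q\<^sup>2 - 2 * (u * (z + x*y)) * p - 2 * (v * (z - x*y)) * q + ((1 - x\<^sup>2) * (1 - y\<^sup>2) - u\<^sup>2 - v\<^sup>2) \<ge> 0" for p q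
      using that(1)[of p q] unfolding slice_form_def e .
    note q = two_variable_quadratic[OF this]
    have "(1 - x\<^sup>2) * (1 - y\<^sup>2) = A + (z + x*y)\<^sup>2" "(1 - x\<^sup>2) * (1 - y\<^sup>2) = B + (z - x*y)\<^sup>2"
      unfolding e[symmetric] by algebra+
    thus ?thesis using q by (simp only: power_mult_distrib) blast
  qed
  note R1 = R[OF F(1)] and R2 = R[OF F(2)] and R3 = R[OF F(3)]
  have A0: "A \<ge> 0" using R1 by simp
  thus "a\<^sup>2 + b\<^sup>2 + c\<^sup>2 + 2*a*b*c \<le> 1" by (simp add: A_def)
  have AB: "A \<le> B" using assms by (simp add: A_def B_def)
  have nz: "a > 0 \<or> b > 0 \<or> c > 0" if "A = 0"
    using that assms by (auto simp: A_def less_le)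
  \<comment> \<open>At A = 0 the factor to be cancelled is P = (z + xy)^2, so a rotation with z + xy
    > 0 has to be found.\<close>
  have nz': "c + a*b > 0 \<or> a + b*c > 0 \<or> b + c*a > 0" if "A = 0"
    using nz[OF that] assms by (auto intro: add_pos_nonneg)
  have u0: "u = 0" if "A = 0"
    using nz'[OF that] that R1 R2 R3 by auto
  thus "a\<^sup>2 + b\<^sup>2 + c\<^sup>2 + 2*a*b*c = 1 \<Longrightarrow> u = 0" by (simp add: A_def)
  have "u\<^sup>2 + v\<^sup>2 \<le> B"
  proof (cases "A = 0")
    case True
    have *: "v\<^sup>2 \<le> B" if "z + x*y > 0" "\<And>p q. slice_form x y z u v p q \<ge> 0" 
        "(x,y,z) \<in> {(a,b,c),(b,c,a),(c,a,b)}" for x y z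
    proof -
      define P where "P = (1 - x\<^sup>2) * (1 - y\<^sup>2)"
      have P: "P = (z + x*y)\<^sup>2" "(z - x*y)\<^sup>2 = P - B" "v\<^sup>2 * (z - x*y)\<^sup>2 \<le> B * (P - v\<^sup>2)"
        using R[OF that(2,3)] True u0[OF True] by (auto simp: P_def)
      have "P > 0" using P(1) that(1) by simp
      have "v\<^sup>2 * P \<le> B * P" using P(3) unfolding P(2) by (simp add: algebra_simps)
      thus ?thesis using \<open>P > 0\<close> by simp
    qed
    have "v\<^sup>2 \<le> B" using nz'[OF True] *[of c a b] *[of a b c] *[of b c a] F by blast
    thus ?thesis using u0[OF True] by simp
  next
    case False
    hence Ap: "A > 0" using A0 by simp
    define P where "P = (1 - a\<^sup>2) * (1 - b\<^sup>2)"
    have P: "(c + a*b)\<^sup>2 = P - A" "(c - a*b)\<^sup>2 = P - B" 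
        "A * (v\<^sup>2 * (c - a*b)\<^sup>2) + B * (u\<^sup>2 * (c + a*b)\<^sup>2) \<le> A * B * (P - u\<^sup>2 - v\<^sup>2)"
      using R1 Ap by (auto simp: P_def)
    have "P > 0" using P(1) Ap zero_le_power2[of "c + a*b"] by linarith
    have "(A * v\<^sup>2 + B * u\<^sup>2) * P \<le> (A * B) * P" using P(3) unfolding P(1,2) by (simp add: algebra_simps)
    hence "A * v\<^sup>2 + B * u\<^sup>2 \<le> A * B" using \<open>P > 0\<close> by simp
    moreover have "A * u\<^sup>2 \<le> B * u\<^sup>2" using AB by (intro mult_right_mono) auto
    ultimately have "A * (u\<^sup>2 + v\<^sup>2) \<le> A * B" by (simp add: algebra_simps)
    thus ?thesis using Ap by simp
  qed
  thus "u\<^sup>2 + v\<^sup>2 \<le> 1 - a\<^sup>2 - b\<^sup>2 - c\<^sup>2 + 2*a*b*c" by (simp add: B_def)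
qed

text \<open>Adding s to |d|^2 <= B gives at most 1 + 2abc <= 5/4. Equality forces abc = 1/8, hence a
  = b = c = 1/2, hence A = 0 and u = 0.\<close>

lemma slice_form_extremal:
  fixes a b c u v :: real
  assumes "a \<ge> 0" "b \<ge> 0" "c \<ge> 0"
    and "\<And>p q. slice_form a b c u v p q \<ge> 0" "\<And>p q. slice_form b c a u v p q \<ge> 0"
      "\<And>p q. slice_form c a b u v p q \<ge> 0"
  shows "a\<^sup>2 + b\<^sup>2 + c\<^sup>2 + u\<^sup>2 + v\<^sup>2 \<le> 5/4"
    "a\<^sup>2 + b\<^sup>2 + c\<^sup>2 + u\<^sup>2 + v\<^sup>2 = 5/4 \<Longrightarrow> a = 1/2 \<and> b = 1/2 \<and> c = 1/2 \<and> u = 0 \<and> v\<^sup>2 = 1/2"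
proof -
  note s = slice_form_bound[OF assms]
  note m = sum_le_one_prod_le[OF assms(1-3) s(1)]
  show "a\<^sup>2 + b\<^sup>2 + c\<^sup>2 + u\<^sup>2 + v\<^sup>2 \<le> 5/4" using s(3) m(1) by linarith
  assume e: "a\<^sup>2 + b\<^sup>2 + c\<^sup>2 + u\<^sup>2 + v\<^sup>2 = 5/4"
  hence "a * b * c = 1/8" using s(3) m(1) by linarith
  hence abc: "a = 1/2" "b = 1/2" "c = 1/2" using m(2) by auto
  have "u = 0" by (intro s(2)) (simp add: abc power2_eq_square)
  thus "a = 1/2 \<and> b = 1/2 \<and> c = 1/2 \<and> u = 0 \<and> v\<^sup>2 = 1/2"
    using e unfolding abc by (simp add: power2_eq_square)
qed

subsection \<open>Canonical form\<close>

definition qvec :: "complex \<Rightarrow> complex \<Rightarrow> qubit" where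
  "qvec x y = (\<lambda>i. if i then y else x)"

text \<open>l|000> + a|011> + b|101> + c|110> + d|111>.\<close>
definition canon :: "complex \<Rightarrow> complex \<Rightarrow> complex \<Rightarrow> complex \<Rightarrow> complex \<Rightarrow> state3" where
  "canon l a b c d = (\<lambda>i j k. if i then (if j then (if k then d else c) else (if k then b else 0))
     else (if j then (if k then a else 0) else (if k then 0 else l)))"

lemma snorm2_canon:
  "snorm2 (canon l a b c d) = (cmod l)\<^sup>2 + (cmod a)\<^sup>2 + (cmod b)\<^sup>2 + (cmod c)\<^sup>2 + (cmod d)\<^sup>2"
  by (simp add: snorm2_def canon_def sum_bool)

text \<open>First-order optimality: moving one of the three maximizing vectors towards the orthogonal
  direction must not increase the overlap.\<close>
lemma max_entry_neighbours_zero: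
  assumes "cmod (psi False False False) = G3 psi"
  shows "psi True False False = 0" "psi False True False = 0" "psi False False True = 0"
proof -
  \<comment> \<open>The test vector below is the column (x, y) of \<open>psi\<close> through |000>,
    the best direction in that slot. Its overlap is its squared norm N, so N^2 <= |x|^2 N.\<close>
  have N: "cmod y = 0" if "(cmod (cnj x * x + cnj y * y))\<^sup>2 \<le> (cmod x)\<^sup>2 * ((cmod x)\<^sup>2 + (cmod y)\<^sup>2)" for x y
  proof -
    define N where "N = (cmod x)\<^sup>2 + (cmod y)\<^sup>2"
    have e: "cnj x * x + cnj y * y = complex_of_real N"
      by (simp only: N_def of_real_add complex_norm_square mult.commute)
    have "(cmod (complex_of_real N))\<^sup>2 \<le> (cmod x)\<^sup>2 * N"
      using that by (simp only: e N_def)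
    hence "N * N \<le> (cmod x)\<^sup>2 * N" by (simp add: power2_eq_square)
    moreover have "N \<ge> 0" by (simp add: N_def)
    ultimately have "N = 0 \<or> N \<le> (cmod x)\<^sup>2" by (metis mult_right_le_imp_le order_le_less)
    hence "(cmod y)\<^sup>2 \<le> 0" unfolding N_def using zero_le_power2[of "cmod x"] zero_le_power2[of "cmod y"] by linarith
    thus ?thesis by simp
  qed
  have "(cmod (overlap3 (\<lambda>i. psi i False False) (qvec 1 0) (qvec 1 0) psi))\<^sup>2 \<le> (G3 psi)\<^sup>2
       * qnorm2 (\<lambda>i. psi i False False) * qnorm2 (qvec 1 0) * qnorm2 (qvec 1 0)"
    by (rule overlap3_bound)
  thus "psi True False False = 0"
    using N[of "psi False False False" "psi True False False"]
    by (simp add: overlap3_def qnorm2_def qvec_def sum_bool assms)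
  have "(cmod (overlap3 (qvec 1 0) (\<lambda>i. psi False i False) (qvec 1 0) psi))\<^sup>2 \<le> (G3 psi)\<^sup>2
       * qnorm2 (qvec 1 0) * qnorm2 (\<lambda>i. psi False i False) * qnorm2 (qvec 1 0)"
    by (rule overlap3_bound)
  thus "psi False True False = 0"
    using N[of "psi False False False" "psi False True False"]
    by (simp add: overlap3_def qnorm2_def qvec_def sum_bool assms)
  have "(cmod (overlap3 (qvec 1 0) (qvec 1 0) (\<lambda>i. psi False False i) psi))\<^sup>2 \<le> (G3 psi)\<^sup>2
       * qnorm2 (qvec 1 0) * qnorm2 (qvec 1 0) * qnorm2 (\<lambda>i. psi False False i)"
    by (rule overlap3_bound)
  thus "psi False False True = 0"
    using N[of "psi False False False" "psi False False True"]
    by (simp add: overlap3_def qnorm2_def qvec_def sum_bool assms)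
qed

text \<open>For normalized \<open>x\<close> the first column is \<open>x\<close> and the second its
  orthogonal complement, so the adjoint rotates \<open>x\<close> to |0>.\<close>

definition qframe :: "qubit \<Rightarrow> qmat" where
  "qframe x = (\<lambda>r s. if s then (if r then cnj (x False) else - cnj (x True)) else x r)"

lemma unitary2_qframe:
  assumes "normalized1 x"
  shows "unitary2 (qframe x)"
proof -
  have "complex_of_real (qnorm2 x) = 1" using assms by (simp add: normalized1_iff)
  hence "x False * cnj (x False) + x True * cnj (x True) = 1"
    by (simp only: qnorm2_def sum_bool of_real_add complex_norm_square)
  thus ?thesis
    by (auto simp: unitary2_def qframe_def sum_bool algebra_simps)
qed

text \<open>Rotating a closest product vector to |000> gives that amplitude modulus G, and
  first-order optimality removes its three neighbours.\<close>

lemma lu_equiv_complex_canon: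
  obtains l a b c d where "lu_equiv psi (canon l a b c d)" "cmod l = G3 psi"
proof -
  obtain x y z where n: "normalized1 x" "normalized1 y" "normalized1 z"
    "G3 psi = cmod (overlap3 x y z psi)" by (rule G3_attained)
  define chi where "chi = local_apply (qadj (qframe x)) (qadj (qframe y)) (qadj (qframe z)) psi"
  have "lu_equiv chi psi"
    by (rule lu_equivI[of "qadj (qframe x)" "qadj (qframe y)" "qadj (qframe z)" 1])
      (use n in \<open>simp_all add: unitary2_qadj unitary2_qframe chi_def\<close>)
  hence e: "lu_equiv psi chi" by (rule lu_equiv_sym)
  have "chi False False False = overlap3 x y z psi"
    by (simp add: chi_def local_apply_def overlap3_def qadj_def qframe_def)
  hence m: "cmod (chi False False False) = G3 chi"
    using n(4) lu_equiv_G3[OF e] by simp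
  have "chi = canon (chi False False False) (chi False True True) (chi True False True)
     (chi True True False) (chi True True True)"
  proof (intro ext)
    fix i j k show "chi i j k = canon (chi False False False) (chi False True True) (chi True False True)
       (chi True True False) (chi True True True) i j k"
      using max_entry_neighbours_zero[OF m] by (cases i; cases j; cases k; simp add: canon_def)
  qed
  thus ?thesis using that e m lu_equiv_G3[OF e] by metis
qed

definition qphase :: "real \<Rightarrow> qmat" where
  "qphase t = (\<lambda>r s. if r = s then (if r then cis t else 1) else 0)"

lemma unitary2_qphase: "unitary2 (qphase t)"
  by (auto simp: unitary2_def qphase_def sum_bool cis_cnj cis_mult)

lemma canon_phases:
  obtains d' where "lu_equiv (canon l a b c d) (canon (cmod l) (cmod a) (cmod b) (cmod c) d')"
proof -
  define A B C where "A = Arg a - Arg l" and "B = Arg b - Arg l" and "C = Arg c - Arg l"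
  \<comment> \<open>Solution of \<beta> + \<gamma> = A, \<alpha> + \<gamma> = B, \<alpha> + \<beta>
    = C, the phases picked up by |011>, |101>, |110>. The global phase takes care of l, and d keeps
    whatever phase remains.\<close>
  define \<alpha> \<beta> \<gamma> where "\<alpha> = (B + C - A) / 2" and "\<beta> = (A + C - B) / 2" and "\<gamma> = (A + B - C) / 2"
  define d' where "d' = cis (- (Arg l + \<alpha> + \<beta> + \<gamma>)) * d"
  have s: "Arg l + \<beta> + \<gamma> = Arg a" "Arg l + \<alpha> + \<gamma> = Arg b" "Arg l + \<alpha> + \<beta> = Arg c"
    by (simp_all add: \<alpha>_def \<beta>_def \<gamma>_def A_def B_def C_def field_simps)
  have p: "cis (Arg z) * complex_of_real (cmod z) = z" for z
    using rcis_cmod_Arg[of z] by (simp add: rcis_def mult.commute)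
  have "lu_equiv (canon l a b c d) (canon (cmod l) (cmod a) (cmod b) (cmod c) d')"
  proof (rule lu_equivI[of "qphase \<alpha>" "qphase \<beta>" "qphase \<gamma>" "cis (Arg l)"])
    fix i j k
    have "cis (Arg l) * (cis \<beta> * (cis \<gamma> * complex_of_real (cmod a))) = a"
      "cis (Arg l) * (cis \<alpha> * (cis \<gamma> * complex_of_real (cmod b))) = b"
      "cis (Arg l) * (cis \<alpha> * (cis \<beta> * complex_of_real (cmod c))) = c"
      using p[of a] p[of b] p[of c] unfolding s[symmetric] by (simp_all only: cis_mult[symmetric] mult.assoc)
    moreover have "cis (Arg l) * (cis \<alpha> * (cis \<beta> * (cis \<gamma> * d'))) = d"
      by (simp add: d'_def cis_mult mult.assoc[symmetric] add.assoc)
    ultimately show "canon l a b c d i j k = cis (Arg l) *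
        local_apply (qphase \<alpha>) (qphase \<beta>) (qphase \<gamma>) (canon (cmod l) (cmod a) (cmod b) (cmod c) d') i j k"
      using p[of l] by (cases i; cases j; cases k; simp add: local_apply_nested qphase_def canon_def sum_bool)
  qed (simp_all add: unitary2_qphase)
  thus ?thesis by (rule that)
qed

section \<open>Optimality of the canonical state expressed by slice forms\<close>

lemma slice_form_nonneg:
  fixes a b c u v p q :: real
  assumes "\<And>a0 a1 b0 b1. (cmod (a0 * (Complex p q * b0 + of_real a * b1)
       + a1 * (of_real b * b0 + (of_real c * Complex p q + Complex u v) * b1)))\<^sup>2
     \<le> ((cmod (Complex p q))\<^sup>2 + 1) * ((cmod a0)\<^sup>2 + (cmod a1)\<^sup>2) * ((cmod b0)\<^sup>2 + (cmod b1)\<^sup>2)"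
  shows "slice_form a b c u v p q \<ge> 0"
proof -
  \<comment> \<open>With L = |x|^2 + 1 the terms |x|^2 |c x + d|^2 cancel, which is why only degree
    two in p and q survives.\<close>
  have "((cmod (Complex p q))\<^sup>2 + 1)\<^sup>2 - ((cmod (Complex p q))\<^sup>2 + 1) * ((cmod (Complex p q))\<^sup>2
       + (cmod (of_real a))\<^sup>2 + (cmod (of_real b))\<^sup>2 + (cmod (of_real c * Complex p q + Complex u v))\<^sup>2)
       + (cmod (Complex p q * (of_real c * Complex p q + Complex u v) - of_real a * of_real b))\<^sup>2
     = slice_form a b c u v p q"
    unfolding cmod_power2 slice_form_def plus_complex.sel minus_complex.sel times_complex.sel
      complex.sel Re_complex_of_real Im_complex_of_real
    by (simp add: power2_eq_square algebra_simps)
  thus ?thesis using bilinear_bound_det[OF assms] by (simp only:)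
qed

text \<open>The three forms arise by contracting the third, the first and the second qubit with (x,
  1), in this order. Test vectors are conjugated to make the overlap trilinear, and the common
  factor l^2 cancels.\<close>

lemma canon_slice_forms:
  fixes l a b c u v p q :: real
  assumes l: "l > 0" "G3 (canon l (l * a) (l * b) (l * c) (l * Complex u v)) = l"
  shows "slice_form a b c u v p q \<ge> 0" "slice_form b c a u v p q \<ge> 0" "slice_form c a b u v p q \<ge> 0"
proof -
  define X D where "X = Complex p q" and "D = Complex u v"
  let ?psi = "canon l (l * a) (l * b) (l * c) (l * D)"
  have n: "qnorm2 (qvec (cnj x) (cnj y)) = (cmod x)\<^sup>2 + (cmod y)\<^sup>2" for x y
    by (simp add: qnorm2_def qvec_def sum_bool)
  have ov: "overlap3 (qvec (cnj x0) (cnj x1)) (qvec (cnj y0) (cnj y1)) (qvec (cnj z0) (cnj z1)) ?psi =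
     of_real l * (x0 * y0 * z0 + of_real a * x0 * y1 * z1 + of_real b * x1 * y0 * z1 + of_real c * x1 * y1 * z0
       + D * x1 * y1 * z1)" for x0 x1 y0 y1 z0 z1
    by (simp add: overlap3_def canon_def qvec_def sum_bool algebra_simps)
  have V: "(cmod (x0 * y0 * z0 + of_real a * x0 * y1 * z1 + of_real b * x1 * y0 * z1 + of_real c * x1 * y1 * z0
       + D * x1 * y1 * z1))\<^sup>2
     \<le> ((cmod x0)\<^sup>2 + (cmod x1)\<^sup>2) * ((cmod y0)\<^sup>2 + (cmod y1)\<^sup>2) * ((cmod z0)\<^sup>2 + (cmod z1)\<^sup>2)"
     (is "?z \<le> ?N") for x0 x1 y0 y1 z0 z1
  proof -
    have "l\<^sup>2 * ?z \<le> l\<^sup>2 * ?N"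
      using overlap3_bound[of "qvec (cnj x0) (cnj x1)" "qvec (cnj y0) (cnj y1)" "qvec (cnj z0) (cnj z1)" ?psi]
      unfolding n l(2)[folded D_def] ov norm_mult power_mult_distrib by (simp add: mult.assoc)
    thus ?thesis using l(1) by simp
  qed
  show "slice_form a b c u v p q \<ge> 0"
  proof (rule slice_form_nonneg, fold X_def D_def, goal_cases)
    case (1 a0 a1 b0 b1)
    have "a0 * (X * b0 + of_real a * b1) + a1 * (of_real b * b0 + (of_real c * X + D) * b1) =
      a0 * b0 * X + of_real a * a0 * b1 * 1 + of_real b * a1 * b0 * 1 + of_real c * a1 * b1 * X + D * a1 * b1 * 1"
      by algebra
    thus ?case using V[of a0 b0 X b1 1 a1] by (simp only: mult_ac norm_one one_power2)
  qed
  show "slice_form b c a u v p q \<ge> 0"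
  proof (rule slice_form_nonneg, fold X_def D_def, goal_cases)
    case (1 a0 a1 b0 b1)
    have "a0 * (X * b0 + of_real b * b1) + a1 * (of_real c * b0 + (of_real a * X + D) * b1) =
      X * a0 * b0 + of_real a * X * a1 * b1 + of_real b * 1 * a0 * b1 + of_real c * 1 * a1 * b0 + D * 1 * a1 * b1"
      by algebra
    thus ?case using V[of X a0 b0 a1 b1 1] by (simp only: mult_ac norm_one one_power2)
  qed
  show "slice_form c a b u v p q \<ge> 0"
  proof (rule slice_form_nonneg, fold X_def D_def, goal_cases)
    case (1 a0 a1 b0 b1)
    have "a0 * (X * b0 + of_real c * b1) + a1 * (of_real a * b0 + (of_real b * X + D) * b1) =
      b0 * X * a0 + of_real a * b0 * 1 * a1 + of_real b * b1 * X * a1 + of_real c * b1 * 1 * a0 + D * b1 * 1 * a1"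
      by algebra
    thus ?case using V[of b0 X a0 1 a1 b1] by (simp only: mult_ac norm_one one_power2)
  qed
qed

text \<open>Overlaps with basis product vectors are the amplitudes, so G = 0 would annihilate the
  state.\<close>

lemma G3_pos:
  assumes "snorm2 psi \<noteq> 0"
  shows "G3 psi > 0"
proof (rule ccontr)
  assume "\<not> G3 psi > 0"
  hence g: "G3 psi = 0" using G3_nonneg[of psi] by simp
  have "psi i j k = 0" for i j k
  proof -
    let ?e = "\<lambda>i r. if r = i then 1 else 0 :: complex"
    have "overlap3 (?e i) (?e j) (?e k) psi = psi i j k"
      by (cases i; cases j; cases k; simp add: overlap3_def sum_bool)
    thus ?thesis using overlap3_bound[of "?e i" "?e j" "?e k" psi] g by simp
  qed
  thus False using assms by (simp add: snorm2_def)
qed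

lemma lu_equiv_real_canon:
  assumes "snorm2 psi \<noteq> 0"
  obtains a b c u v where "a \<ge> 0" "b \<ge> 0" "c \<ge> 0"
    "lu_equiv psi (canon (G3 psi) (G3 psi * a) (G3 psi * b) (G3 psi * c) (G3 psi * Complex u v))"
proof -
  define g where "g = G3 psi"
  have g: "g > 0" using G3_pos[OF assms] by (simp add: g_def)
  obtain l a b c d where 1: "lu_equiv psi (canon l a b c d)" "cmod l = g"
    unfolding g_def by (rule lu_equiv_complex_canon)
  obtain d' where 2: "lu_equiv (canon l a b c d) (canon (cmod l) (cmod a) (cmod b) (cmod c) d')"
    by (rule canon_phases)
  have d: "complex_of_real g * Complex (Re (d' / g)) (Im (d' / g)) = d'"
    using g by (simp add: complex_eq_iff)
  have "lu_equiv psi (canon g (g * (cmod a / g)) (g * (cmod b / g)) (g * (cmod c / g))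
      (g * Complex (Re (d' / g)) (Im (d' / g))))"
    using lu_equiv_trans[OF 1(1) 2] g unfolding d by (simp add: 1(2))
  thus ?thesis using g by (intro that[of "cmod a / g" "cmod b / g" "cmod c / g"]) (auto simp: g_def)
qed

section \<open>The W state: its canonical form and its maximal overlap\<close>

lemma W_state_lu_equiv_canon:
  fixes t :: real
  assumes "t\<^sup>2 = 2/9"
  shows "lu_equiv (canon (2/3) (1/3) (1/3) (1/3) (\<i> * t)) W_state"
proof -
  define x y where "x = complex_of_real (1 / sqrt 3)" and "y = complex_of_real (sqrt 2 / sqrt 3)"
  \<comment> \<open>\<open>s\<close> is the sign of \<open>t\<close>, as t = sqrt 2 / 3 up to sign;
    carrying it in \<open>R\<close> treats both signs at once.\<close>
  define s where "s = complex_of_real (3 * t / sqrt 2)"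
  have "(3 * t / sqrt 2)\<^sup>2 = 1" "(1 / sqrt 3)\<^sup>2 = 1/3" "(sqrt 2 / sqrt 3)\<^sup>2 = 2/3"
    using assms by (simp_all add: power_mult_distrib power_divide)
  hence "complex_of_real ((3 * t / sqrt 2)\<^sup>2) = 1" "complex_of_real ((1 / sqrt 3)\<^sup>2) = 1/3"
    "complex_of_real ((sqrt 2 / sqrt 3)\<^sup>2) = 2/3"
    by (simp_all only: of_real_1 of_real_divide of_real_numeral)
  hence sq: "x * x = 1/3" "y * y = 2/3" "s * s = 1"
    by (simp_all only: x_def y_def s_def of_real_power power2_eq_square of_real_mult)
  have cn: "cnj x = x" "cnj y = y" "cnj s = s" by (simp_all add: x_def y_def s_def)
  have t: "complex_of_real t = s * (x * y)"
    unfolding s_def x_def y_def of_real_mult[symmetric] of_real_eq_iff by (simp add: field_simps)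
  define R :: qmat where "R = (\<lambda>i j. if i then (if j then - \<i> * s * y else \<i> * s * x) else (if j then x else y))"
  have W: "W_state i j k = (if (i \<and> \<not> j \<and> \<not> k) \<or> (\<not> i \<and> j \<and> \<not> k) \<or> (\<not> i \<and> \<not> j \<and> k) then x else 0)" for i j k
    by (simp add: W_state_def x_def)
  txt \<open>The rows of R are the closest product vector (sqrt 2, 1)/sqrt 3 of W and its
    orthogonal complement, with the phase that makes a, b, c positive.\<close>
  show ?thesis
  proof (rule lu_equivI[of R R R 1])
    show u: "unitary2 R"
      unfolding unitary2_def
    proof (intro allI)
      fix r q show "(\<Sum>k\<in>UNIV. cnj (R k r) * R k q) = (if r = q then 1 else 0)"
        using sq i_squared by (cases r; cases q; simp add: R_def sum_bool cn; algebra)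
    qed
    show "unitary2 R" "unitary2 R" by (fact u)+
    fix i j k
    show "canon (2/3) (1/3) (1/3) (1/3) (\<i> * t) i j k = 1 * local_apply R R R W_state i j k"
      unfolding t using sq i_squared
      by (cases i; cases j; cases k; simp add: R_def sum_bool local_apply_nested W canon_def; algebra)
  qed simp
qed

lemma G3_W_state: "G3 W_state = 2/3"
proof (rule G3_eqI[of "qvec (sqrt 2 / sqrt 3) (1 / sqrt 3)" "qvec (sqrt 2 / sqrt 3) (1 / sqrt 3)"
      "qvec (sqrt 2 / sqrt 3) (1 / sqrt 3)"])
  let ?e = "qvec (sqrt 2 / sqrt 3) (1 / sqrt 3)"
  show n: "normalized1 ?e" by (simp add: normalized1_iff qnorm2_def qvec_def sum_bool norm_divide power_divide)
  show "normalized1 ?e" "normalized1 ?e" by (fact n)+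
  have "overlap3 (qvec y x) (qvec y x) (qvec y x) W_state = 3 * y * y * x * complex_of_real (1 / sqrt 3)"
    for x y :: real
    by (simp add: overlap3_def W_state_def qvec_def sum_bool)
  hence "overlap3 ?e ?e ?e W_state =
      complex_of_real (3 * (sqrt 2 / sqrt 3) * (sqrt 2 / sqrt 3) * (1 / sqrt 3) * (1 / sqrt 3))"
    by (simp only: of_real_mult of_real_numeral)
  also have "3 * (sqrt 2 / sqrt 3) * (sqrt 2 / sqrt 3) * (1 / sqrt 3) * (1 / sqrt 3) = 2/3"
    by (simp add: field_simps)
  finally have "overlap3 ?e ?e ?e W_state = complex_of_real (2/3)" .
  thus "cmod (overlap3 ?e ?e ?e W_state) = 2/3" by (simp only: norm_of_real)
next
  fix a b c assume n: "normalized1 a" "normalized1 b" "normalized1 c"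
  define a0 a1 where "a0 = cmod (a False)" and "a1 = cmod (a True)"
  define b0 b1 where "b0 = cmod (b False)" and "b1 = cmod (b True)"
  define c0 c1 where "c0 = cmod (c False)" and "c1 = cmod (c True)"
  have n': "a0\<^sup>2 + a1\<^sup>2 = 1" "b0\<^sup>2 + b1\<^sup>2 = 1" "c0\<^sup>2 + c1\<^sup>2 = 1"
    using n by (simp_all add: normalized1_iff qnorm2_def sum_bool a0_def a1_def b0_def b1_def c0_def c1_def)
  define P Q where "P = b0 * c0" and "Q = b1 * c0 + b0 * c1"
  \<comment> \<open>Sum-of-squares certificate for P^2 + Q^2 <= 4/3; both squares vanish at the
    maximizer (sqrt 2, 1)/sqrt 3.\<close>
  have "4 * ((b0\<^sup>2 + b1\<^sup>2) * (c0\<^sup>2 + c1\<^sup>2)) - 3 * (P\<^sup>2 + Q\<^sup>2) =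
     (b0 * c0 - 2 * (b1 * c1))\<^sup>2 + (b0 * c1 - b1 * c0)\<^sup>2" (is "?l = ?r")
    unfolding P_def Q_def by algebra
  moreover have "0 \<le> ?r" by simp
  ultimately have "0 \<le> ?l" by (simp only:)
  hence PQ: "P\<^sup>2 + Q\<^sup>2 \<le> 4/3" unfolding n' by simp
  \<comment> \<open>Lagrange's identity, giving Cauchy-Schwarz for the first qubit.\<close>
  have "(a1 * P + a0 * Q)\<^sup>2 + (a0 * P - a1 * Q)\<^sup>2 = (a0\<^sup>2 + a1\<^sup>2) * (P\<^sup>2 + Q\<^sup>2)" by algebra
  moreover have "(a0 * P - a1 * Q)\<^sup>2 \<ge> 0" by simp
  ultimately have "(a1 * P + a0 * Q)\<^sup>2 \<le> 4/3" using PQ unfolding n' mult_1 by linarith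
  hence S: "(a1 * P + a0 * Q)\<^sup>2 / 3 \<le> (2/3)\<^sup>2" by (simp add: power2_eq_square)
  have "overlap3 a b c W_state = complex_of_real (1 / sqrt 3) * (cnj (a True) * cnj (b False) * cnj (c False)
      + (cnj (a False) * cnj (b True) * cnj (c False) + cnj (a False) * cnj (b False) * cnj (c True)))"
    by (simp add: overlap3_def W_state_def sum_bool algebra_simps)
  hence "cmod (overlap3 a b c W_state) = 1 / sqrt 3 * cmod (cnj (a True) * cnj (b False) * cnj (c False)
      + (cnj (a False) * cnj (b True) * cnj (c False) + cnj (a False) * cnj (b False) * cnj (c True)))"
    by (simp only: norm_mult norm_of_real) simp
  also have "\<dots> \<le> 1 / sqrt 3 * (a1 * b0 * c0 + (a0 * b1 * c0 + a0 * b0 * c1))"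
    unfolding a0_def a1_def b0_def b1_def c0_def c1_def
    by (intro mult_left_mono norm_triangle_mono) (simp_all add: norm_mult)
  also have "\<dots> = (a1 * P + a0 * Q) / sqrt 3" by (simp add: P_def Q_def algebra_simps add_divide_distrib)
  also have "\<dots> \<le> 2/3"
    by (rule power2_le_imp_le) (use S in \<open>simp_all add: power_divide\<close>)
  finally show "cmod (overlap3 a b c W_state) \<le> 2/3" .
qed

section \<open>The bound, the equality case and the theorem\<close>

lemma G3_lower_bound:
  assumes "snorm2 psi = 1"
  shows "(G3 psi)\<^sup>2 \<ge> 4/9" "(G3 psi)\<^sup>2 = 4/9 \<Longrightarrow> lu_equiv psi W_state"
proof -
  define g where "g = G3 psi"
  have nz: "snorm2 psi \<noteq> 0" using assms by simp
  obtain a b c u v where e: "a \<ge> 0" "b \<ge> 0" "c \<ge> 0"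
    "lu_equiv psi (canon g (g * a) (g * b) (g * c) (g * Complex u v))"
    unfolding g_def by (rule lu_equiv_real_canon[OF nz])
  let ?chi = "canon g (g * a) (g * b) (g * c) (g * Complex u v)"
  have g: "g > 0" using G3_pos[of psi] assms by (simp add: g_def)
  have "G3 ?chi = g" using lu_equiv_G3[OF e(4)] by (simp add: g_def)
  note x = slice_form_extremal[OF e(1-3) canon_slice_forms[OF g this]]
  have "snorm2 ?chi = 1" using lu_equiv_snorm2[OF e(4)] assms by simp
  hence n: "g\<^sup>2 * (1 + (a\<^sup>2 + b\<^sup>2 + c\<^sup>2 + u\<^sup>2 + v\<^sup>2)) = 1"
    by (simp add: snorm2_canon norm_mult power_mult_distrib cmod_power2 algebra_simps)
  have "g\<^sup>2 * (1 + (a\<^sup>2 + b\<^sup>2 + c\<^sup>2 + u\<^sup>2 + v\<^sup>2)) \<le> g\<^sup>2 * (1 + 5/4)"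
    by (intro mult_left_mono add_left_mono x(1)) simp
  thus "(G3 psi)\<^sup>2 \<ge> 4/9" using n by (simp add: g_def)
  assume "(G3 psi)\<^sup>2 = 4/9"
  hence g2: "g\<^sup>2 = 4/9" by (simp add: g_def)
  hence "a\<^sup>2 + b\<^sup>2 + c\<^sup>2 + u\<^sup>2 + v\<^sup>2 = 5/4" using n unfolding g2 by simp
  from x(2)[OF this] have v: "a = 1/2" "b = 1/2" "c = 1/2" "u = 0" "v\<^sup>2 = 1/2" by auto
  have "g\<^sup>2 = (2/3)\<^sup>2" using g2 by (simp add: power2_eq_square)
  hence g23: "g = 2/3" using g by (simp add: power2_eq_iff_nonneg)
  have d: "complex_of_real (2/3) * Complex 0 v = \<i> * complex_of_real (2/3 * v)"
    by (simp add: complex_eq_iff)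
  have h: "complex_of_real (2/3) = 2/3" "complex_of_real (2/3) * complex_of_real (1/2) = 1/3" by simp_all
  \<comment> \<open>Equality fixes v only up to sign; the canonical form of W admits either.\<close>
  have "(2/3 * v)\<^sup>2 = 2/9" using v(5) by (simp add: power_mult_distrib power2_eq_square)
  from W_state_lu_equiv_canon[OF this] have "lu_equiv ?chi W_state"
    unfolding g23 v(1-4) d by simp
  with e(4) show "lu_equiv psi W_state" by (rule lu_equiv_trans)
qed

theorem theorem1:
  shows "(G3 W_state)\<^sup>2 = 4/9 \<and> EG3 W_state = 5/9 \<and>
    (\<forall>psi. normalized3 psi \<longrightarrow>
       (G3 psi)\<^sup>2 \<ge> (G3 W_state)\<^sup>2 \<and> EG3 psi \<le> EG3 W_state \<and>
       ((G3 psi)\<^sup>2 = (G3 W_state)\<^sup>2 \<longleftrightarrow>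
          (\<exists>U1 U2 U3 (\<phi>::real). unitary2 U1 \<and> unitary2 U2 \<and> unitary2 U3 \<and>
             psi = (\<lambda>i j k. exp (\<i> * complex_of_real \<phi>) * local_apply U1 U2 U3 W_state i j k))))"
proof -
  have W: "(G3 W_state)\<^sup>2 = 4/9" by (simp add: G3_W_state power2_eq_square)
  have lu: "lu_equiv psi W_state \<longleftrightarrow> (\<exists>U1 U2 U3 (\<phi>::real). unitary2 U1 \<and> unitary2 U2 \<and> unitary2 U3 \<and>
             psi = (\<lambda>i j k. exp (\<i> * complex_of_real \<phi>) * local_apply U1 U2 U3 W_state i j k))" for psi
  proof
    assume "lu_equiv psi W_state"
    then obtain U1 U2 U3 w where u: "unitary2 U1" "unitary2 U2" "unitary2 U3" "cmod w = 1"
      "psi = (\<lambda>i j k. w * local_apply U1 U2 U3 W_state i j k)"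
      unfolding lu_equiv_def by blast
    \<comment> \<open>The modulus-one factor of \<open>lu_equiv\<close> is turned into the real
      phase of the statement.\<close>
    obtain t where t: "exp (\<i> * complex_of_real t) = w"
      using u(4) unfolding complex_norm_eq_1_exp by (rule that)
    show "\<exists>U1 U2 U3 (\<phi>::real). unitary2 U1 \<and> unitary2 U2 \<and> unitary2 U3 \<and>
        psi = (\<lambda>i j k. exp (\<i> * complex_of_real \<phi>) * local_apply U1 U2 U3 W_state i j k)"
      by (intro exI[of _ U1] exI[of _ U2] exI[of _ U3] exI[of _ t] conjI u(1-3)) (simp only: t u(5))
  next
    assume "\<exists>U1 U2 U3 (\<phi>::real). unitary2 U1 \<and> unitary2 U2 \<and> unitary2 U3 \<and>
        psi = (\<lambda>i j k. exp (\<i> * complex_of_real \<phi>) * local_apply U1 U2 U3 W_state i j k)"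
    then obtain U1 U2 U3 and \<phi> :: real where u: "unitary2 U1" "unitary2 U2" "unitary2 U3"
      "psi = (\<lambda>i j k. exp (\<i> * complex_of_real \<phi>) * local_apply U1 U2 U3 W_state i j k)"
      by (elim exE conjE)
    show "lu_equiv psi W_state"
      by (rule lu_equivI[OF u(1-3), of "exp (\<i> * complex_of_real \<phi>)"]) (simp_all add: u(4))
  qed
  have psi: "(G3 psi)\<^sup>2 \<ge> 4/9" "(G3 psi)\<^sup>2 = 4/9 \<longleftrightarrow> lu_equiv psi W_state"
    if "normalized3 psi" for psi
  proof -
    have n: "snorm2 psi = 1" using that by (simp only: normalized3_def snorm2_def)
    show "(G3 psi)\<^sup>2 \<ge> 4/9" by (rule G3_lower_bound(1)[OF n])
    show "(G3 psi)\<^sup>2 = 4/9 \<longleftrightarrow> lu_equiv psi W_state"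
    proof
      show "(G3 psi)\<^sup>2 = 4/9 \<Longrightarrow> lu_equiv psi W_state" by (rule G3_lower_bound(2)[OF n])
      assume "lu_equiv psi W_state"
      thus "(G3 psi)\<^sup>2 = 4/9" by (simp only: lu_equiv_G3 W)
    qed
  qed
  show ?thesis
    unfolding W EG3_def lu[symmetric]
  proof (intro conjI allI impI)
    fix psi assume n: "normalized3 psi"
    show "(G3 psi)\<^sup>2 \<ge> 4/9" "(G3 psi)\<^sup>2 = 4/9 \<longleftrightarrow> lu_equiv psi W_state" by (fact psi[OF n])+
    show "1 - (G3 psi)\<^sup>2 \<le> 1 - 4/9" using psi(1)[OF n] by linarith
  qed simp_all
qed

end
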